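(* Let $(X,X_+,\mathcal K,f)$ be an abstract state space whose cone $X_+$ is $\lambda$-generating, let $P$ be a projection on $X$, and let $T,S\in\Sigma_P^{inv}(X)$. If $T\in\Sigma_P^u(X)$, then there are constants $C,\alpha>0$ and $n_0\in\mathbb N$ with $\|T^n-P\|\le Ce^{-\alpha n}$ for all $n\ge n_0$ such that, with $$\tilde n:=\left[\frac{\log(1/C)}{\log e^{-\alpha}}\right],$$ for all $x,z\in\mathcal K$ with $x-z\in N_P$ and all $n\in\mathbb N$ one has $$\|T^nx-S^nz\|\le\begin{cases}\|x-z\|+n\|T-S\|, & n\le\tilde n,\\[2mm] \lambda Ce^{-\alpha n}\|x-z\|+\left(\tilde n+\lambda C\,\dfrac{e^{-\alpha\tilde n}-e^{-\alpha n}}{1-e^{-\alpha}}\right)\|T-S\|, & n\ge\tilde n+1.\end{cases}$$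
   Context: Let $X$ be a real ordered vector space with generating cone $X_+$ ($X=X_+-X_+$), let $f$ be a strictly positive linear functional on $X$ ($f(x)>0$ for $x>0$), and let $\mathcal K=\{x\in X_+: f(x)=1\}$. Let $U$ be the convex hull of $\mathcal K\cup(-\mathcal K)$ and $\|x\|=\inf\{t\ge 0: x\in tU\}$. $(X,X_+,\mathcal K,f)$ is an abstract state space if this seminorm is a norm, $X$ is complete for it, and $X_+$ is closed; $X$ always carries this norm. The cone $X_+$ is $\lambda$-generating ($\lambda\ge1$) if every $x\in X$ can be written $x=y-z$ with $y,z\in X_+$ and $\|y\|+\|z\|\le\lambda\|x\|$. A linear operator $T:X\to X$ is Markov if it is positive and $T(\mathcal K)\subset\mathcal K$. A projection is a bounded linear operator $P$ with $P^2=P$; $N_P=\{x\in X: Px=0\}$. $\Sigma_P(X)$ is the set of Markov operators $T$ with $TP=PT$; $\Sigma_P^{inv}(X)=\{T\in\Sigma_P(X): TP=P\}$; $\Sigma_P^u(X)=\{T\in\Sigma_P(X):\|T^n-P\|\to0\}$. $[\cdot]$ denotes the integer part (floor). $\mathbb N=\{1,2,\dots\}$. *)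

theory Defs
  imports "HOL-Analysis.Analysis"
begin

text \<open>
  The ordered vector space \<open>X\<close> is a type of sort \<open>ordered_real_vector\<close>, and its cone is
  \<open>{0..}\<close>. The norm of \<open>X\<close> is the norm of the type: the sort \<open>banach\<close> says that it is a
  complete norm, and \<open>abstract_state_space\<close> requires it to be the Minkowski functional of
  the convex hull of \<open>\<K> \<union> -\<K>\<close>.
\<close>

definition state_base :: "('a::ordered_real_vector \<Rightarrow> real) \<Rightarrow> 'a set" where
  "state_base f = {x. 0 \<le> x \<and> f x = 1}"

definition state_hull :: "('a::ordered_real_vector \<Rightarrow> real) \<Rightarrow> 'a set" where
  "state_hull f = convex hull (state_base f \<union> uminus ` state_base f)"

definition abstract_state_space :: "('a::{banach, ordered_real_vector} \<Rightarrow> real) \<Rightarrow> bool" where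
  "abstract_state_space f \<longleftrightarrow>
     (\<forall>x::'a. \<exists>y\<ge>0. \<exists>z\<ge>0. x = y - z) \<and>
     linear f \<and> (\<forall>x>0. f x > 0) \<and>
     (\<forall>x. norm x = Inf {t. 0 \<le> t \<and> x \<in> (\<lambda>u. t *\<^sub>R u) ` state_hull f}) \<and>
     closed {0::'a..}"

definition lambda_generating :: "real \<Rightarrow> 'a::real_normed_vector set \<Rightarrow> bool" where
  "lambda_generating l K \<longleftrightarrow>
     1 \<le> l \<and> (\<forall>x. \<exists>y\<in>K. \<exists>z\<in>K. x = y - z \<and> norm y + norm z \<le> l * norm x)"

text \<open>Boundedness is not assumed: on an abstract state space a Markov operator is a contraction.\<close>

definition markov :: "('a::ordered_real_vector \<Rightarrow> real) \<Rightarrow> ('a \<Rightarrow> 'a) \<Rightarrow> bool" where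
  "markov f T \<longleftrightarrow> linear T \<and> (\<forall>x\<ge>0. 0 \<le> T x) \<and> T ` state_base f \<subseteq> state_base f"

definition bounded_projection :: "('a::real_normed_vector \<Rightarrow> 'a) \<Rightarrow> bool" where
  "bounded_projection P \<longleftrightarrow> bounded_linear P \<and> P \<circ> P = P"

definition null_space :: "('a::real_vector \<Rightarrow> 'a) \<Rightarrow> 'a set" where
  "null_space P = {x. P x = 0}"

definition Sigma_P :: "('a::ordered_real_vector \<Rightarrow> real) \<Rightarrow> ('a \<Rightarrow> 'a) \<Rightarrow> ('a \<Rightarrow> 'a) set" where
  "Sigma_P f P = {T. markov f T \<and> T \<circ> P = P \<circ> T}"

definition Sigma_P_inv :: "('a::ordered_real_vector \<Rightarrow> real) \<Rightarrow> ('a \<Rightarrow> 'a) \<Rightarrow> ('a \<Rightarrow> 'a) set" where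
  "Sigma_P_inv f P = {T \<in> Sigma_P f P. T \<circ> P = P}"

definition Sigma_P_u ::
    "('a::{real_normed_vector, ordered_real_vector} \<Rightarrow> real) \<Rightarrow> ('a \<Rightarrow> 'a) \<Rightarrow> ('a \<Rightarrow> 'a) set" where
  "Sigma_P_u f P = {T \<in> Sigma_P f P. (\<lambda>n. onorm (\<lambda>x. (T ^^ n) x - P x)) \<longlonglongrightarrow> 0}"

end

theory Submission
  imports Defs
begin

text \<open>
  On an abstract state space every Markov operator is a contraction, because it maps the
  symmetric convex set \<open>state_hull f\<close>, whose Minkowski functional is the norm, into itself.
  Put \<open>D = T - S\<close>. Since \<open>T\<close> and \<open>S\<close> both absorb \<open>P\<close>, the range of \<open>D\<close> lies in the null
  space of \<open>P\<close>. On that null space \<open>T ^^ k\<close> agrees with \<open>T ^^ k - P\<close>, so there it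
  has norm at most \<open>min 1 (C * exp (- \<alpha> * k))\<close>.

  The constants come from the identity
  \<open>T ^^ (m + n) - P = (T ^^ m - P) \<circ> (T ^^ n - P)\<close>, which makes the norms of
  \<open>T ^^ n - P\<close> submultiplicative: a submultiplicative sequence that tends to 0 decays
  exponentially from the very first index on, with some \<open>C \<ge> 1\<close>.

  Swapping one factor \<open>T\<close> for \<open>S\<close> at a time gives
  \<open>(T ^^ n) x - (S ^^ n) z = (T ^^ n) (x - z) + (\<Sum>k<n. (T ^^ k) (D ((S ^^ (n - 1 - k)) z)))\<close>,
  where \<open>(S ^^ i) z\<close> has norm at most 1. Every summand is therefore bounded by
  \<open>min 1 (C * exp (- \<alpha> * k))\<close> times the norm of \<open>D\<close>. The integer part of \<open>ln C / \<alpha>\<close> is the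
  index at which the second argument of the minimum takes over: up to it the terms are
  counted, and after it they are dominated by a geometric series. As \<open>l \<ge> 1\<close>, passing from
  \<open>C\<close> to \<open>l * C\<close> only weakens the resulting bound.
\<close>

section \<open>Markov operators are contractions\<close>

lemma state_hull_markov_image:
  assumes "markov f T"
  shows "T ` state_hull f \<subseteq> state_hull f"
proof -
  have T: "linear T" "T ` state_base f \<subseteq> state_base f"
    using assms by (auto simp: markov_def)
  have "T ` (state_base f \<union> uminus ` state_base f) \<subseteq> state_base f \<union> uminus ` state_base f"
    using T by (auto simp: linear_neg image_subset_iff)
  then show ?thesis
    unfolding state_hull_def convex_hull_linear_image[OF T(1)] by (rule hull_mono)
qed

text \<open>
  The infimum of the empty set of reals carries no information, so bounds on the Minkowski
  functional need this: a nonzero \<open>x = y - z\<close> is \<open>f y + f z\<close> times a convex combination of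
  the normalisations of \<open>y\<close> and \<open>-z\<close>.
\<close>

lemma state_hull_absorbing:
  assumes "abstract_state_space f" and "x \<noteq> 0"
  obtains t where "0 \<le> t" "x \<in> (\<lambda>u. t *\<^sub>R u) ` state_hull f"
proof -
  have f: "linear f" "\<And>x. x > 0 \<Longrightarrow> f x > 0"
    using assms(1) by (auto simp: abstract_state_space_def)
  obtain y z where yz: "y \<ge> 0" "z \<ge> 0" "x = y - z"
    using assms(1) unfolding abstract_state_space_def by blast
  let ?U = "state_base f \<union> uminus ` state_base f"
  have norm1: "(1 / f w) *\<^sub>R w \<in> state_base f" if "w > 0" for w
    using f(2)[OF that] that
    by (auto simp: state_base_def linear_scale[OF f(1)] intro!: scaleR_nonneg_nonneg)
  have U: "(1 / f w) *\<^sub>R w \<in> state_hull f" "- ((1 / f w) *\<^sub>R w) \<in> state_hull f" if "w > 0" for w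
    using norm1[OF that] hull_subset[of ?U convex] by (auto simp: state_hull_def)
  consider "y > 0" "z = 0" | "y = 0" "z > 0" | "y > 0" "z > 0"
    using yz assms(2) by fastforce
  then show thesis
  proof cases
    case 1
    then show thesis
      using that[of "f y"] f(2)[of y] U(1)[of y] yz(3) by force
  next
    case 2
    then show thesis
      using that[of "f z"] f(2)[of z] U(2)[of z] yz(3) by (force simp: image_iff)
  next
    case 3
    then have pos: "f y > 0" "f z > 0" using f(2) by auto
    let ?t = "f y + f z"
    let ?u = "(f y / ?t) *\<^sub>R ((1 / f y) *\<^sub>R y) + (f z / ?t) *\<^sub>R (- ((1 / f z) *\<^sub>R z))"
    have "?u \<in> state_hull f"
    proof (rule convexD)
      show "convex (state_hull f)" by (simp add: state_hull_def)
      show "f y / ?t + f z / ?t = 1" using pos by (simp flip: add_divide_distrib)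
    qed (use U(1)[OF 3(1)] U(2)[OF 3(2)] pos in auto)
    moreover have "?t *\<^sub>R ?u = x"
      using pos yz(3) by (simp add: scaleR_add_right scaleR_diff_right)
    ultimately show thesis
      using that[of ?t] pos by (metis add_nonneg_nonneg imageI less_imp_le)
  qed
qed

lemma markov_contraction:
  fixes f :: "'a::{banach, ordered_real_vector} \<Rightarrow> real"
  assumes A: "abstract_state_space f" and M: "markov f T"
  shows "norm (T x) \<le> norm x"
proof (cases "x = 0")
  case True
  then show ?thesis using M by (simp add: markov_def linear_0)
next
  case False
  define B where "B x = {t. 0 \<le> t \<and> x \<in> (\<lambda>u. t *\<^sub>R u) ` state_hull f}" for x
  have N: "norm x = Inf (B x)" for x
    using A unfolding abstract_state_space_def B_def by blast
  have T: "linear T" using M by (simp add: markov_def)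
  have "B x \<noteq> {}"
    using state_hull_absorbing[OF A False] unfolding B_def by blast
  moreover have "bdd_below (B (T x))"
    unfolding B_def by (rule bdd_belowI[of _ 0]) auto
  moreover have "B x \<subseteq> B (T x)"
    using state_hull_markov_image[OF M] by (fastforce simp: B_def linear_scale[OF T])
  ultimately show ?thesis
    unfolding N by (rule cInf_superset_mono)
qed

lemma norm_state_base_le_1:
  fixes f :: "'a::{banach, ordered_real_vector} \<Rightarrow> real"
  assumes A: "abstract_state_space f" and x: "x \<in> state_base f"
  shows "norm x \<le> 1"
proof -
  have "x \<in> state_hull f"
    using x unfolding state_hull_def by (intro hull_inc) auto
  then have "1 \<in> {t. 0 \<le> t \<and> x \<in> (\<lambda>u. t *\<^sub>R u) ` state_hull f}"
    by auto
  moreover have "bdd_below {t. 0 \<le> t \<and> x \<in> (\<lambda>u. t *\<^sub>R u) ` state_hull f}"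
    by (rule bdd_belowI[of _ 0]) auto
  moreover have "norm x = Inf {t. 0 \<le> t \<and> x \<in> (\<lambda>u. t *\<^sub>R u) ` state_hull f}"
    using A unfolding abstract_state_space_def by blast
  ultimately show ?thesis
    by (metis cInf_lower)
qed

lemma markov_funpow: "markov f T \<Longrightarrow> markov f (T ^^ n)"
  by (induction n)
    (auto simp: markov_def linear_id[unfolded id_def] linear_compose[unfolded comp_def]
      image_subset_iff id_def comp_def)

lemma markov_bounded_linear:
  fixes f :: "'a::{banach, ordered_real_vector} \<Rightarrow> real"
  assumes "abstract_state_space f" and "markov f T"
  shows "bounded_linear T"
  using assms markov_contraction[OF assms]
  by (intro bounded_linear_intro[where K = 1]) (auto simp: markov_def linear_add linear_scale)

section \<open>Exponential decay of submultiplicative sequences\<close>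

text \<open>
  Some \<open>a m\<close> is below \<open>1/2\<close>, so \<open>a\<close> halves along every block of \<open>m\<close> indices; this gives
  the rate \<open>ln 2 / m\<close>. An incomplete block costs at most a factor 2 and a bound of \<open>a\<close>.
\<close>

lemma submultiplicative_exp_decay:
  fixes a :: "nat \<Rightarrow> real"
  assumes nonneg: "\<And>n. 0 \<le> a n"
    and submult: "\<And>m n. a (m + n) \<le> a m * a n"
    and lim: "a \<longlonglongrightarrow> 0"
  obtains C \<alpha> where "1 \<le> C" "0 < \<alpha>" "\<And>n. a n \<le> C * exp (- \<alpha> * real n)"
proof -
  have "\<forall>\<^sub>F n in sequentially. a n < 1/2"
    using lim by (rule order_tendstoD) simp
  then obtain N where "\<And>n. n \<ge> N \<Longrightarrow> a n < 1/2"
    by (auto simp: eventually_sequentially)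
  then obtain m where m: "m > 0" "a m < 1/2"
    by (metis le_add1 le_add2 less_le_trans zero_less_one)
  from lim have "Bseq a"
    by (meson Bseq_eq_bounded convergentI convergent_imp_Bseq)
  then obtain K where K: "K > 0" "\<And>n. norm (a n) \<le> K"
    by (auto elim: BseqE)
  define \<alpha> where "\<alpha> = ln 2 / real m"
  define C where "C = 2 * max 1 K"
  have block: "a (q * m + r) \<le> (1/2) ^ q * a r" for q r
  proof (induction q)
    case (Suc q)
    have "a (Suc q * m + r) \<le> a m * a (q * m + r)"
      using submult[of m "q * m + r"] by (simp add: add.assoc)
    also have "\<dots> \<le> (1/2) * ((1/2) ^ q * a r)"
      using Suc m nonneg by (intro mult_mono) auto
    finally show ?case by simp
  qed simp
  have "a n \<le> C * exp (- \<alpha> * real n)" for n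
  proof -
    let ?q = "n div m" and ?r = "n mod m"
    have "\<alpha> * real n = real ?q * ln 2 + \<alpha> * real ?r"
    proof -
      have "real n = real ?q * real m + real ?r"
        by (metis div_mult_mod_eq of_nat_add of_nat_mult)
      moreover have "\<alpha> * real m = ln 2" using m by (simp add: \<alpha>_def)
      ultimately show ?thesis by (simp add: algebra_simps)
    qed
    moreover have "\<alpha> * real ?r \<le> ln 2"
      using m by (simp add: \<alpha>_def field_simps)
    ultimately have "exp (- real ?q * ln 2) \<le> exp (ln 2 + - \<alpha> * real n)"
      by simp
    also have "\<dots> = 2 * exp (- \<alpha> * real n)"
      by (subst exp_add) simp
    also have "exp (- real ?q * ln 2) = (1/2) ^ ?q"
      by (simp add: exp_minus exp_of_nat_mult power_one_over inverse_eq_divide)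
    finally have half: "(1/2) ^ ?q \<le> 2 * exp (- \<alpha> * real n)" .
    have "a n \<le> (1/2) ^ ?q * a ?r"
      using block[of ?q ?r] by simp
    also have "\<dots> \<le> (2 * exp (- \<alpha> * real n)) * max 1 K"
    proof (rule mult_mono[OF half])
      show "a ?r \<le> max 1 K" using K(2)[of ?r] by auto
    qed (use nonneg in auto)
    finally show ?thesis by (simp add: C_def algebra_simps)
  qed
  moreover have "1 \<le> C" "0 < \<alpha>" using m by (auto simp: C_def \<alpha>_def)
  ultimately show thesis using that by blast
qed

section \<open>Uniform stability gives an exponential rate\<close>

lemma funpow_absorb:
  assumes "T \<circ> P = P" "P \<circ> T = P"
  shows "(T ^^ n) (P x) = P x" "P ((T ^^ n) x) = P x"
  using assms by (induction n) (auto simp: fun_eq_iff)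

text \<open>
  Since \<open>P\<close> absorbs powers of \<open>T\<close> from both sides, the cross terms of
  \<open>(T ^^ m - P) \<circ> (T ^^ n - P)\<close> cancel, and \<open>T ^^ (m + n) - P\<close> remains.
\<close>

lemma onorm_funpow_minus_projection_submult:
  fixes T P :: "'a::real_normed_vector \<Rightarrow> 'a"
  assumes T: "\<And>n. bounded_linear (T ^^ n)" and P: "bounded_linear P" "P \<circ> P = P"
    and TP: "T \<circ> P = P" "P \<circ> T = P"
  shows "onorm (\<lambda>x. (T ^^ (m + n)) x - P x)
    \<le> onorm (\<lambda>x. (T ^^ m) x - P x) * onorm (\<lambda>x. (T ^^ n) x - P x)"
proof -
  have PP: "P (P x) = P x" for x
    using P(2) by (metis comp_apply)
  have "(\<lambda>x. (T ^^ (m + n)) x - P x) = (\<lambda>x. (T ^^ m) x - P x) \<circ> (\<lambda>x. (T ^^ n) x - P x)"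
    by (auto simp: fun_eq_iff funpow_add funpow_absorb[OF TP] PP
        linear_diff[OF bounded_linear.linear[OF T]] linear_diff[OF bounded_linear.linear[OF P(1)]])
  then show ?thesis
    using onorm_compose[OF bounded_linear_sub[OF T P(1)] bounded_linear_sub[OF T P(1)]] by metis
qed

section \<open>Comparing powers of two operators\<close>

text \<open>
  Replacing the factors \<open>T\<close> by \<open>S\<close> one at a time: the replacement to which \<open>k\<close> further
  factors \<open>T\<close> are applied costs \<open>T ^^ k\<close> of \<open>T y - S y\<close>, at a point \<open>y\<close> of the invariant
  set \<open>K\<close>.
\<close>

lemma norm_funpow_diff_le:
  fixes T S :: "'a::real_normed_vector \<Rightarrow> 'a"
  assumes T: "linear T" and S: "S ` K \<subseteq> K"
    and b: "\<And>k y. y \<in> K \<Longrightarrow> norm ((T ^^ k) (T y - S y)) \<le> b k * d"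
    and z: "z \<in> K"
  shows "norm ((T ^^ n) z - (S ^^ n) z) \<le> (\<Sum>k<n. b k) * d"
  using z
proof (induction n arbitrary: z)
  case (Suc n)
  have lin: "(T ^^ n) (u - v) = (T ^^ n) u - (T ^^ n) v" for u v
    by (induction n) (auto simp: linear_diff[OF T])
  have "norm ((T ^^ Suc n) z - (S ^^ Suc n) z)
      = norm ((T ^^ n) (T z - S z) + ((T ^^ n) (S z) - (S ^^ n) (S z)))"
    by (simp add: lin funpow_swap1)
  also have "\<dots> \<le> b n * d + (\<Sum>k<n. b k) * d"
    using Suc.IH[of "S z"] b[OF Suc.prems] S Suc.prems by (intro norm_triangle_mono) auto
  finally show ?case by (simp add: algebra_simps)
qed simp

lemma sum_min_1_exp_le:
  fixes C \<alpha> :: real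
  assumes "0 < \<alpha>" and "m \<le> n"
  shows "(\<Sum>k<n. min 1 (C * exp (- \<alpha> * real k)))
    \<le> real m + C * ((exp (- \<alpha> * real m) - exp (- \<alpha> * real n)) / (1 - exp (- \<alpha>)))"
  using assms(2)
proof (induction n rule: dec_induct)
  case base
  show ?case
    using sum_bounded_above[of "{..<m}" "\<lambda>k. min 1 (C * exp (- \<alpha> * real k))" 1] by simp
next
  case (step n)
  have e: "exp (- \<alpha> * real (Suc n)) = exp (- \<alpha> * real n) * exp (- \<alpha>)"
    by (simp add: algebra_simps flip: exp_add)
  have "exp (- \<alpha>) < 1" using assms(1) by simp
  then have "exp (- \<alpha> * real n)
      = (exp (- \<alpha> * real n) - exp (- \<alpha> * real (Suc n))) / (1 - exp (- \<alpha>))"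
    unfolding e by (simp add: field_simps)
  then have "C * ((exp (- \<alpha> * real m) - exp (- \<alpha> * real (Suc n))) / (1 - exp (- \<alpha>)))
      = C * ((exp (- \<alpha> * real m) - exp (- \<alpha> * real n)) / (1 - exp (- \<alpha>)))
        + C * exp (- \<alpha> * real n)"
    by (metis (no_types, opaque_lifting) add_diff_eq add_divide_distrib diff_add_cancel distrib_left)
  then show ?case using step.IH by simp
qed

text \<open>
  Both differences that occur, \<open>x - z\<close> and \<open>T y - S y\<close>, are killed by \<open>P\<close>, so that the
  decay of \<open>T ^^ k - P\<close> applies to them; the minimum with 1 is the contractivity of \<open>T\<close>.
  Keeping both bounds in one formula lets the two regimes in \<open>n\<close> be read off from it.
\<close>

lemma norm_funpow_diff_min_exp:
  fixes f :: "'a::{banach, ordered_real_vector} \<Rightarrow> real"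
  assumes A: "abstract_state_space f" and P: "bounded_projection P"
    and T: "T \<in> Sigma_P_inv f P" and S: "S \<in> Sigma_P_inv f P"
    and rate: "\<And>n. onorm (\<lambda>x. (T ^^ n) x - P x) \<le> C * exp (- \<alpha> * real n)"
    and x: "x \<in> state_base f" and z: "z \<in> state_base f" and xz: "x - z \<in> null_space P"
  shows "norm ((T ^^ n) x - (S ^^ n) z)
    \<le> min 1 (C * exp (- \<alpha> * real n)) * norm (x - z)
      + (\<Sum>k<n. min 1 (C * exp (- \<alpha> * real k))) * onorm (\<lambda>y. T y - S y)"
proof -
  let ?b = "\<lambda>k. min 1 (C * exp (- \<alpha> * real k))"
  have MT: "markov f T" and MS: "markov f S"
    using T S by (auto simp: Sigma_P_inv_def Sigma_P_def)
  have Pl: "linear P" and PT: "P (T y) = P y" and PS: "P (S y) = P y" for y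
    using P T S by (auto simp: bounded_projection_def bounded_linear.linear
        Sigma_P_inv_def Sigma_P_def fun_eq_iff)
  have diff_bl: "bounded_linear (\<lambda>x. (T ^^ k) x - P x)" for k
    using markov_bounded_linear[OF A markov_funpow[OF MT]] P
    by (auto simp: bounded_projection_def intro: bounded_linear_sub)
  have null: "norm ((T ^^ k) y) \<le> ?b k * norm y" if "P y = 0" for k y
  proof -
    have "norm ((T ^^ k) y) \<le> onorm (\<lambda>x. (T ^^ k) x - P x) * norm y"
      using onorm[OF diff_bl, of k y] that by simp
    also have "\<dots> \<le> C * exp (- \<alpha> * real k) * norm y"
      using rate by (rule mult_right_mono) simp
    finally show ?thesis
      using markov_contraction[OF A markov_funpow[OF MT], of k y] by (auto simp: min_def)
  qed
  have step: "norm ((T ^^ k) (T y - S y)) \<le> ?b k * onorm (\<lambda>y. T y - S y)"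
    if y: "y \<in> state_base f" for k y
  proof -
    let ?D = "\<lambda>y. T y - S y"
    have bl: "bounded_linear ?D"
      using MT MS A by (intro bounded_linear_sub markov_bounded_linear)
    have "norm (?D y) \<le> onorm ?D * norm y" by (rule onorm[OF bl])
    also have "\<dots> \<le> onorm ?D"
      using norm_state_base_le_1[OF A y] onorm_pos_le[OF bl] by (simp add: mult_left_le)
    finally have D: "norm (?D y) \<le> onorm ?D" .
    have "0 \<le> C * exp (- \<alpha> * real k)"
      using onorm_pos_le[OF diff_bl] rate by (rule order_trans)
    then have "?b k * norm (?D y) \<le> ?b k * onorm ?D"
      using D by (intro mult_left_mono) auto
    moreover have "P (?D y) = 0"
      by (simp add: linear_diff[OF Pl] PT PS)
    ultimately show ?thesis
      using null[of "?D y" k] by linarith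
  qed
  have "(T ^^ n) x - (S ^^ n) z = (T ^^ n) (x - z) + ((T ^^ n) z - (S ^^ n) z)"
    using markov_funpow[OF MT, of n] by (simp add: markov_def linear_diff)
  also have "norm \<dots> \<le> ?b n * norm (x - z) + (\<Sum>k<n. ?b k) * onorm (\<lambda>y. T y - S y)"
  proof (rule norm_triangle_mono)
    show "norm ((T ^^ n) (x - z)) \<le> ?b n * norm (x - z)"
      using xz by (intro null) (simp add: null_space_def)
    show "norm ((T ^^ n) z - (S ^^ n) z) \<le> (\<Sum>k<n. ?b k) * onorm (\<lambda>y. T y - S y)"
      using MT MS z step
      by (intro norm_funpow_diff_le[where K = "state_base f"]) (auto simp: markov_def)
  qed
  finally show ?thesis .
qed

section \<open>The perturbation bound\<close>

theorem theorem7p1: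
  fixes f :: "'a::{banach, ordered_real_vector} \<Rightarrow> real"
    and l :: real
    and P T S :: "'a \<Rightarrow> 'a"
  assumes "abstract_state_space f"
    and "lambda_generating l {0::'a..}"
    and "bounded_projection P"
    and "T \<in> Sigma_P_inv f P"
    and "S \<in> Sigma_P_inv f P"
    and "T \<in> Sigma_P_u f P"
  shows "\<exists>(C::real) > 0. \<exists>(\<alpha>::real) > 0. \<exists>(n0::nat) \<ge> 1.
    (\<forall>n\<ge>n0. onorm (\<lambda>x. (T ^^ n) x - P x) \<le> C * exp (- \<alpha> * real n)) \<and>
    (let nt = \<lfloor>ln (1 / C) / ln (exp (- \<alpha>))\<rfloor> in
      \<forall>x\<in>state_base f. \<forall>z\<in>state_base f. x - z \<in> null_space P \<longrightarrow>
        (\<forall>n::nat. 1 \<le> n \<longrightarrow>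
          (int n \<le> nt \<longrightarrow>
            norm ((T ^^ n) x - (S ^^ n) z)
              \<le> norm (x - z) + real n * onorm (\<lambda>y. T y - S y)) \<and>
          (int n \<ge> nt + 1 \<longrightarrow>
            norm ((T ^^ n) x - (S ^^ n) z)
              \<le> l * C * exp (- \<alpha> * real n) * norm (x - z)
                 + (real_of_int nt
                     + l * C * ((exp (- \<alpha> * real_of_int nt) - exp (- \<alpha> * real n))
                                / (1 - exp (- \<alpha>))))
                   * onorm (\<lambda>y. T y - S y))))"
proof -
  have l: "1 \<le> l" using assms(2) by (simp add: lambda_generating_def)
  have MT: "markov f T" and MS: "markov f S" and TP: "T \<circ> P = P" "P \<circ> T = P"
    using assms(4,5) by (auto simp: Sigma_P_inv_def Sigma_P_def)
  have P: "bounded_linear P" "P \<circ> P = P"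
    using assms(3) by (auto simp: bounded_projection_def)
  note bT = markov_bounded_linear[OF assms(1) markov_funpow[OF MT]]
  have onn: "0 \<le> onorm (\<lambda>y. T y - S y)"
    using MT MS assms(1) by (intro onorm_pos_le bounded_linear_sub markov_bounded_linear)
  obtain C \<alpha> where C: "1 \<le> C" and \<alpha>: "0 < \<alpha>"
    and rate: "\<And>n. onorm (\<lambda>x. (T ^^ n) x - P x) \<le> C * exp (- \<alpha> * real n)"
  proof (rule submultiplicative_exp_decay)
    show "(\<lambda>n. onorm (\<lambda>x. (T ^^ n) x - P x)) \<longlonglongrightarrow> 0"
      using assms(6) by (simp add: Sigma_P_u_def)
    show "0 \<le> onorm (\<lambda>x. (T ^^ n) x - P x)" for n
      using bT P(1) by (intro onorm_pos_le bounded_linear_sub)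
    show "onorm (\<lambda>x. (T ^^ (m + n)) x - P x)
        \<le> onorm (\<lambda>x. (T ^^ m) x - P x) * onorm (\<lambda>x. (T ^^ n) x - P x)" for m n
      by (rule onorm_funpow_minus_projection_submult[OF bT P TP])
  qed blast
  define nt where "nt = \<lfloor>ln (1 / C) / ln (exp (- \<alpha>))\<rfloor>"
  \<comment> \<open>As \<open>C \<ge> 1\<close>, the cut-off index is a natural number.\<close>
  have "0 \<le> nt" using C \<alpha> by (simp add: nt_def ln_div)
  then obtain m where m: "nt = int m" by (metis nonneg_int_cases)
  let ?d = "onorm (\<lambda>y. T y - S y)" and ?b = "\<lambda>k. min 1 (C * exp (- \<alpha> * real k))"
  have short: "norm ((T ^^ n) x - (S ^^ n) z) \<le> norm (x - z) + real n * ?d"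
    if B: "norm ((T ^^ n) x - (S ^^ n) z) \<le> ?b n * norm (x - z) + (\<Sum>k<n. ?b k) * ?d" for n x z
  proof -
    have "(\<Sum>k<n. ?b k) \<le> real n"
      using sum_bounded_above[of "{..<n}" ?b 1] by simp
    then have "(\<Sum>k<n. ?b k) * ?d \<le> real n * ?d" using onn by (rule mult_right_mono)
    moreover have "?b n * norm (x - z) \<le> 1 * norm (x - z)" by (intro mult_right_mono) auto
    ultimately show ?thesis using B by linarith
  qed
  have long: "norm ((T ^^ n) x - (S ^^ n) z)
      \<le> l * C * exp (- \<alpha> * real n) * norm (x - z)
        + (real m + l * C * ((exp (- \<alpha> * real m) - exp (- \<alpha> * real n)) / (1 - exp (- \<alpha>)))) * ?d"
    if B: "norm ((T ^^ n) x - (S ^^ n) z) \<le> ?b n * norm (x - z) + (\<Sum>k<n. ?b k) * ?d"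
      and mn: "m \<le> n" for n x z
  proof -
    let ?g = "(exp (- \<alpha> * real m) - exp (- \<alpha> * real n)) / (1 - exp (- \<alpha>))"
    have lC: "C \<le> l * C" using l C by simp
    have "0 \<le> ?g" using \<alpha> mn by (intro divide_nonneg_nonneg) auto
    then have "C * ?g \<le> l * C * ?g" using lC by (rule mult_right_mono[rotated])
    then have "(\<Sum>k<n. ?b k) \<le> real m + l * C * ?g"
      using sum_min_1_exp_le[OF \<alpha> mn, of C] by linarith
    then have "(\<Sum>k<n. ?b k) * ?d \<le> (real m + l * C * ?g) * ?d" using onn by (rule mult_right_mono)
    moreover have "C * exp (- \<alpha> * real n) \<le> l * C * exp (- \<alpha> * real n)"
      using lC by (intro mult_right_mono) auto
    then have "?b n * norm (x - z) \<le> l * C * exp (- \<alpha> * real n) * norm (x - z)"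
      by (intro mult_right_mono) auto
    ultimately show ?thesis using B by linarith
  qed
  note bound = norm_funpow_diff_min_exp[OF assms(1,3,4,5) rate]
  show ?thesis
    unfolding Let_def
  proof (intro exI[of _ C] exI[of _ \<alpha>] exI[of _ "1::nat"] conjI allI impI ballI,
      unfold nt_def[symmetric] m)
    show "C > 0" using C by simp
  next
    fix x z n
    assume "x \<in> state_base f" "z \<in> state_base f" "x - z \<in> null_space P"
    note B = bound[OF this, of n]
    show "norm ((T ^^ n) x - (S ^^ n) z) \<le> norm (x - z) + real n * ?d"
      by (rule short[OF B])
    assume "int m + 1 \<le> int n"
    then show "norm ((T ^^ n) x - (S ^^ n) z)
      \<le> l * C * exp (- \<alpha> * real n) * norm (x - z)
        + (real_of_int (int m) + l * C * ((exp (- \<alpha> * real_of_int (int m)) - exp (- \<alpha> * real n))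
          / (1 - exp (- \<alpha>)))) * ?d"
      using long[OF B] by simp
  qed (use \<alpha> rate in auto)
qed

end
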